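(* There is an $\varepsilon_0>0$ (depending on the problem data, the method parameters and the linear system solver) such that for every unit roundoff $0<\varepsilon_{mach}\le\varepsilon_0$ the following holds. Let $\tilde z\in\mathcal{N}(\hat\tau,\nu_1)$, where $\hat\tau\in[\sigma\tau_E,\sigma\tau_A]$. Solve the linear system $$DF(\tilde z)\,\Delta\tilde z=-F_{\hat\tau}(\tilde z)$$ on an IEEE machine with unit roundoff $\varepsilon_{mach}$ with a numerically stable algorithm, and compute $\hat{\tilde z}:=\tilde z+\Delta\tilde z$. Then $\hat{\tilde z}\in\mathcal{N}_h(\hat\tau,\nu_2)$.
   Context: $n,m\ge1$; $Q\in\mathbb{R}^{n\times n}$ symmetric positive semidefinite, $c\in\mathbb{R}^n$, $A\in\mathbb{R}^{m\times n}$, $b\in\mathbb{R}^m$, $\mathrm{tol}>0$. $\mathbf 1$ is the all-ones vector; products of vectors of equal length are componentwise. $\|\cdot\|_2$ is the Euclidean/spectral norm, $\|\cdot\|_F$ the Frobenius norm. Method parameters: positive reals satisfying (an upper bound with zero denominator is vacuous) $\theta\le0.3$; $\beta\le\theta$; $1-\beta/\sqrt{2n}\le\sigma<1$; $N=3n+m$; $C_q\ge\|Q\|_2n+\|c\|_2\sqrt n$; $\omega\le\min\{\frac{\mathrm{tol}}{2n},\frac{\mathrm{tol}^2}{16(4C_q+n)},1\}$; $C_\lambda\ge(\|A\|_2\sqrt n+\|b\|_2)/\omega$; $C_{\Delta\mu}\ge(\omega+\|Q\|_2)\sqrt n+\|c\|_2+\|A\|_2C_\lambda$; $\tau_A\ge\max\{\frac14\|Q+\omega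 I+\frac1\omega A^{\mathsf T}A\|_2,4\|c-\frac1\omega A^{\mathsf T}b\|_2\}$; $\tau_E\le\frac{\mathrm{tol}^2\omega}{48n\max\{\|A\|_2,C_q\}}$; $C_\mu\ge\sqrt{2n}(C_{\Delta\mu}+(1+\theta)\tau_A)$; $C_z\ge\sqrt{n+C_\lambda^2+C_\mu^2}+0.1$; $c_{gap}\le\frac{1-\theta}{1+C_z}\cdot\frac{\sigma\tau_E}2$; $C_{DF}\ge\|Q\|_2+2\omega+2\|A\|_F+4+4C_z$; $C_{DFinv}\ge\frac1{c_{gap}}\max\{\frac1\omega,\frac{C_z}{c_{gap}}\}$; $\kappa_{DF}\ge C_{DF}C_{DFinv}$; $C_{\delta F}\ge C_{DF}$; $C_{\delta DF}\ge2$; $C_{\delta\Delta z}\ge2\kappa_{DF}$; $C_\nu\ge\max\{2C_{\delta\Delta z}(C_{\delta F}C_{DFinv}+\frac2\omega C_{\delta DF}C_z),1+C_{DFinv}C_{\delta F}\}$; $\nu_2\le\min\{0.1,\frac{c_{gap}}{C_\nu},\frac\omega{2C_{\delta DF}\kappa_{DF}},\frac{\theta\sigma\tau_E}{2C_\nu C_{\delta F}}\}$; $\nu_1\le\nu_2/C_\nu$; $\nu_0\le\min\{\nu_1/C_\nu,\frac{\mathrm{tol}}{2\max\{\|A\|_2,C_q\}}\}$. The numbers $\nu_0,\nu_1$ are fixed positive reals. For $z=(x,\lambda,\mu_L,\mu_R)\in\mathbb{R}^n\times\mathbb{R}^m\times\mathbb{R}^n\times\mathbb{R}^n=\mathbb{R}^N$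 and $\tau>0$: $$F_\tau(z)=\begin{pmatrix}Qx+\omega x+c-A^{\mathsf T}\lambda-\mu_L+\mu_R\\ Ax-b+\omega\lambda\\ \mu_L\cdot(\mathbf 1+x)-\tau\mathbf 1\\ \mu_R\cdot(\mathbf 1-x)-\tau\mathbf 1\end{pmatrix},$$ $$DF(z)=\begin{bmatrix}Q+\omega I&-A^{\mathsf T}&-I&I\\ A&\omega I&0&0\\ \mathrm{diag}(\mu_L)&0&\mathrm{diag}(\mathbf 1+x)&0\\ -\mathrm{diag}(\mu_R)&0&0&\mathrm{diag}(\mathbf 1-x)\end{bmatrix}.$$ $\mathcal{N}(\tau)$ is the set of $z\in\mathbb{R}^N$ with $F_\tau(z)=(0_n,0_m,r^{(3)},r^{(4)})$, $\|(r^{(3)},r^{(4)})\|_2\le\theta\tau$, $\|x\|_\infty<1$, $\mu_L>0$, $\mu_R>0$; $\mathcal{N}_h(\tau)$ is defined in the same way with $\|(r^{(3)},r^{(4)})\|_2\le0.5\,\theta\tau$. Further $\mathcal{N}(\tau,\nu)=\{\tilde z:\exists z\in\mathcal{N}(\tau),\|\tilde z-z\|_2\le\nu\}$ and $\mathcal{N}_h(\tau,\nu)=\{\tilde z:\exists z\in\mathcal{N}_h(\tau),\|\tilde z-z\|_2\le\nu\}$. Rounding model: computing a step $\tilde z+\Delta\tilde z$ with $DF(\tilde z)\Delta\tilde z=-r$ on an IEEE machine with unit roundoff $\varepsilon_{mach}$ and a numerically stable algorithm means that the computed vector equals $\tilde z-DF(\tilde z)^{-1}r+e$ with a rounding error $e\in\mathbb{R}^N$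 obeying $\|e\|_2\le const\cdot C_z\cdot\kappa_{DF}\cdot\varepsilon_{mach}$, where $const$ depends only on the linear system solver. *)

theory Defs
  imports "HOL-Analysis.Analysis"
begin

text \<open>
  An iterate \<open>z = (x, \<lambda>, \<mu>\<^sub>L, \<mu>\<^sub>R)\<close> is a vector of \<open>\<real>\<^sup>N\<close>, \<open>N = 3n + m\<close>, indexed by the sum type
  \<open>'n + 'm + 'n + 'n\<close> with \<open>n = CARD('n)\<close> and \<open>m = CARD('m)\<close>. On the library's vectors \<open>*\<close> is the
  componentwise product and \<open>1\<close> the all-ones vector; \<open>norm\<close> is the Euclidean norm of a vector
  and the Frobenius norm of a matrix; \<open>mat k\<close> is \<open>k\<close> times the identity matrix.
\<close>

type_synonym ('n, 'm) iterate = "(real, 'n + 'm + 'n + 'n) vec"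

definition stack4 :: "'a ^ 'n \<Rightarrow> 'a ^ 'm \<Rightarrow> 'a ^ 'n \<Rightarrow> 'a ^ 'n \<Rightarrow> ('a, 'n + 'm + 'n + 'n) vec" where
  "stack4 u v w y = (\<chi> i. case i of
      Inl k \<Rightarrow> u $ k
    | Inr (Inl k) \<Rightarrow> v $ k
    | Inr (Inr (Inl k)) \<Rightarrow> w $ k
    | Inr (Inr (Inr k)) \<Rightarrow> y $ k)"

definition block_row ::
  "real ^ 'n ^ 'k \<Rightarrow> real ^ 'm ^ 'k \<Rightarrow> real ^ 'n ^ 'k \<Rightarrow> real ^ 'n ^ 'k \<Rightarrow> ('n, 'm) iterate ^ 'k" where
  "block_row M1 M2 M3 M4 = (\<chi> i. stack4 (M1 $ i) (M2 $ i) (M3 $ i) (M4 $ i))"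

definition x_of :: "('n::finite, 'm::finite) iterate \<Rightarrow> real ^ 'n" where
  "x_of z = (\<chi> i. z $ Inl i)"

definition lam_of :: "('n::finite, 'm::finite) iterate \<Rightarrow> real ^ 'm" where
  "lam_of z = (\<chi> i. z $ Inr (Inl i))"

definition muL_of :: "('n::finite, 'm::finite) iterate \<Rightarrow> real ^ 'n" where
  "muL_of z = (\<chi> i. z $ Inr (Inr (Inl i)))"

definition muR_of :: "('n::finite, 'm::finite) iterate \<Rightarrow> real ^ 'n" where
  "muR_of z = (\<chi> i. z $ Inr (Inr (Inr i)))"

definition diag :: "real ^ 'n \<Rightarrow> real ^ 'n ^ 'n" where
  "diag v = (\<chi> i j. if i = j then v $ i else 0)"

definition spectral_norm :: "real ^ 'n ^ 'm \<Rightarrow> real" where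
  "spectral_norm M = onorm (\<lambda>v. M *v v)"

definition sym_psd :: "real ^ 'n ^ 'n \<Rightarrow> bool" where
  "sym_psd Q \<longleftrightarrow> transpose Q = Q \<and> (\<forall>v. 0 \<le> v \<bullet> (Q *v v))"

definition F ::
  "real ^ 'n ^ 'n \<Rightarrow> real ^ 'n \<Rightarrow> real ^ 'n ^ 'm \<Rightarrow> real ^ 'm \<Rightarrow> real \<Rightarrow> real
    \<Rightarrow> ('n, 'm) iterate \<Rightarrow> ('n, 'm) iterate" where
  "F Q c A b \<omega> \<tau> z = stack4
     (Q *v x_of z + \<omega> *\<^sub>R x_of z + c - transpose A *v lam_of z - muL_of z + muR_of z)
     (A *v x_of z - b + \<omega> *\<^sub>R lam_of z)
     (muL_of z * (1 + x_of z) - \<tau> *\<^sub>R 1)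
     (muR_of z * (1 - x_of z) - \<tau> *\<^sub>R 1)"

definition DF ::
  "real ^ 'n ^ 'n \<Rightarrow> real ^ 'n ^ 'm \<Rightarrow> real
    \<Rightarrow> ('n, 'm) iterate \<Rightarrow> ('n, 'm) iterate ^ ('n + 'm + 'n + 'n)" where
  "DF Q A \<omega> z = stack4
     (block_row (Q + mat \<omega>)            (- transpose A) (- mat 1)             (mat 1))
     (block_row A                      (mat \<omega>)         0                     0)
     (block_row (diag (muL_of z))      0               (diag (1 + x_of z))   0)
     (block_row (- diag (muR_of z))    0               0                     (diag (1 - x_of z)))"

text \<open>
  \<open>\<N>(\<tau>)\<close> is \<open>nbhd\<close> with radius factor \<open>\<theta>\<close>, and \<open>\<N>\<^sub>h(\<tau>)\<close> is \<open>nbhd\<close> with radius factor \<open>0.5 \<theta>\<close>.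
  The norm of the pair \<open>(r3, r4)\<close> is the Euclidean norm of the stacked vector.
\<close>

definition nbhd ::
  "real ^ 'n ^ 'n \<Rightarrow> real ^ 'n \<Rightarrow> real ^ 'n ^ 'm \<Rightarrow> real ^ 'm \<Rightarrow> real \<Rightarrow> real \<Rightarrow> real
    \<Rightarrow> ('n, 'm) iterate set" where
  "nbhd Q c A b \<omega> \<theta> \<tau> =
    {z. (\<exists>r3 r4. F Q c A b \<omega> \<tau> z = stack4 0 0 r3 r4 \<and> norm (r3, r4) \<le> \<theta> * \<tau>)
        \<and> infnorm (x_of z) < 1 \<and> (\<forall>i. 0 < muL_of z $ i) \<and> (\<forall>i. 0 < muR_of z $ i)}"

definition enlarge :: "('n::finite, 'm::finite) iterate set \<Rightarrow> real \<Rightarrow> ('n, 'm) iterate set" where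
  "enlarge S \<nu> = {z'. \<exists>z\<in>S. norm (z' - z) \<le> \<nu>}"

text \<open>
  \<open>computed_step M z r \<delta> z'\<close>: \<open>z'\<close> is a possible floating-point result of computing
  \<open>z + \<Delta>z\<close> with \<open>M \<Delta>z = - r\<close>, with total rounding error at most \<open>\<delta>\<close>. Note that
  \<open>matrix_inv M\<close> is meaningful only for invertible \<open>M\<close>, which is not part of this definition.
\<close>

definition computed_step ::
  "('n::finite, 'm::finite) iterate ^ ('n + 'm + 'n + 'n) \<Rightarrow> ('n, 'm) iterate \<Rightarrow> ('n, 'm) iterate \<Rightarrow> real
    \<Rightarrow> ('n, 'm) iterate \<Rightarrow> bool" where
  "computed_step M z r \<delta> z' \<longleftrightarrow> (\<exists>e. norm e \<le> \<delta> \<and> z' = z - matrix_inv M *v r + e)"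

end

theory Submission
  imports Defs
begin

text \<open>
  Write \<open>g = c_gap\<close> and let \<open>z\<^sub>0 \<in> \<N>(\<tau>)\<close> be a point at distance at most \<open>\<nu>\<^sub>1\<close> from the given
  iterate \<open>z\<close>. The map \<open>F\<close> is quadratic: \<open>F (z + d) = F z + DF z d + q d\<close>, where
  \<open>q d = (0, 0, d\<mu>\<^sub>L dx, - d\<mu>\<^sub>R dx)\<close> does not depend on \<open>z\<close>. The proof compares the perturbed
  Newton step from \<open>z\<close> with the exact Newton step from \<open>z\<^sub>0\<close>.

  The exact step \<open>z\<^sub>0 + d\<^sub>0\<close> lies in \<open>\<N>\<^sub>h(\<tau>)\<close> (\<open>newton_step_mem_nbhd\<close>): the new residual is
  \<open>q d\<^sub>0\<close>, and since \<open>Q\<close> is positive semidefinite the entries of \<open>q d\<^sub>0\<close> have nonnegative sum,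
  which bounds its norm by \<open>\<theta>\<^sup>2 \<tau> / (2 (1 - \<theta>)) \<le> \<theta> \<tau> / 2\<close>.

  Points of \<open>\<N>(\<tau>)\<close> are bounded in norm by \<open>C_z - 0.1\<close> (\<open>nbhd_norm_le\<close>) and stay away from the
  boundary (\<open>nbhd_gap\<close>): \<open>1 \<plusminus> x\<close>, \<open>\<mu>\<^sub>L\<close> and \<open>\<mu>\<^sub>R\<close> are at least \<open>2 g\<close>. Since
  \<open>\<nu>\<^sub>1 \<le> min g 0.1\<close>, these quantities are at least \<open>g\<close> at \<open>z\<close>, and \<open>norm z \<le> C_z\<close>. Dividing the last two block rows of \<open>DF z\<close> by \<open>\<mu>\<^sub>L\<close> and \<open>\<mu>\<^sub>R\<close> gives a
  matrix whose symmetric part is at least \<open>min \<omega> (g / C_z)\<close>, so that \<open>DF z\<close> is invertible with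
  inverse bounded by \<open>C_DFinv\<close> (\<open>DF_inverse_bound\<close>).

  Finally (\<open>newton_step_perturbation\<close>), the exact Newton point \<open>z + d\<close> from \<open>z\<close> satisfies
  \<open>DF z ((z + d) - (z\<^sub>0 + d\<^sub>0)) = q (z\<^sub>0 + d\<^sub>0 - z) - q d\<^sub>0\<close>, and both arguments of \<open>q\<close> have
  norm at most \<open>2 C_z\<close> and differ by at most \<open>\<nu>\<^sub>1\<close>. So \<open>z + d\<close> is within
  \<open>8 C_z C_DFinv \<nu>\<^sub>1 \<le> C_\<nu> \<nu>\<^sub>1 / 2 \<le> \<nu>\<^sub>2 / 2\<close> of \<open>z\<^sub>0 + d\<^sub>0\<close>. The other half of \<open>\<nu>\<^sub>2\<close> is left
  for the rounding error, which determines \<open>\<epsilon>\<^sub>0\<close>.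
\<close>

section \<open>Block structure of iterates\<close>

lemma stack4_sel [simp]:
  "x_of (stack4 u v w y) = u" "lam_of (stack4 u v w y) = v"
  "muL_of (stack4 u v w y) = w" "muR_of (stack4 u v w y) = y"
  by (simp_all add: x_of_def lam_of_def muL_of_def muR_of_def stack4_def vec_eq_iff)

lemma stack4_collapse: "stack4 (x_of z) (lam_of z) (muL_of z) (muR_of z) = z"
  by (auto simp: x_of_def lam_of_def muL_of_def muR_of_def stack4_def vec_eq_iff split: sum.split)

lemma stack4_eq_iff:
  fixes u u' w w' y y' :: "real ^ 'n" and v v' :: "real ^ 'm"
  shows "stack4 u v w y = stack4 u' v' w' y' \<longleftrightarrow> u = u' \<and> v = v' \<and> w = w' \<and> y = y'"
  by (metis stack4_sel)

lemma sel_linear [simp]: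
  fixes z z' :: "('n::finite, 'm::finite) iterate"
  shows "x_of (z + z') = x_of z + x_of z'" "lam_of (z + z') = lam_of z + lam_of z'"
    "muL_of (z + z') = muL_of z + muL_of z'" "muR_of (z + z') = muR_of z + muR_of z'"
    "x_of (z - z') = x_of z - x_of z'" "lam_of (z - z') = lam_of z - lam_of z'"
    "muL_of (z - z') = muL_of z - muL_of z'" "muR_of (z - z') = muR_of z - muR_of z'"
    "x_of (- z) = - x_of z" "lam_of (- z) = - lam_of z"
    "muL_of (- z) = - muL_of z" "muR_of (- z) = - muR_of z"
  by (simp_all add: x_of_def lam_of_def muL_of_def muR_of_def vec_eq_iff)

lemma iterate_eqI:
  fixes z z' :: "('n::finite, 'm::finite) iterate"
  assumes "x_of z = x_of z'" "lam_of z = lam_of z'" "muL_of z = muL_of z'" "muR_of z = muR_of z'"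
  shows "z = z'"
  by (metis assms stack4_collapse)

lemma sum_iterate:
  fixes f :: "'n::finite + 'm::finite + 'n + 'n \<Rightarrow> real"
  shows "(\<Sum>i\<in>UNIV. f i) = (\<Sum>i\<in>UNIV. f (Inl i)) + (\<Sum>i\<in>UNIV. f (Inr (Inl i)))
    + (\<Sum>i\<in>UNIV. f (Inr (Inr (Inl i)))) + (\<Sum>i\<in>UNIV. f (Inr (Inr (Inr i))))"
proof -
  have split: "(\<Sum>i\<in>UNIV. g i) = (\<Sum>i\<in>UNIV. g (Inl i)) + (\<Sum>i\<in>UNIV. g (Inr i))"
    for g :: "'a::finite + 'b::finite \<Rightarrow> real"
    using sum.Plus[of "UNIV::'a set" "UNIV::'b set" g] by (simp add: UNIV_Plus_UNIV comp_def)
  show ?thesis by (simp add: split)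
qed

lemma inner_iterate:
  fixes z z' :: "('n::finite, 'm::finite) iterate"
  shows "z \<bullet> z' = x_of z \<bullet> x_of z' + lam_of z \<bullet> lam_of z' + muL_of z \<bullet> muL_of z' + muR_of z \<bullet> muR_of z'"
  by (simp add: inner_vec_def sum_iterate x_of_def lam_of_def muL_of_def muR_of_def)

lemma norm_iterate:
  fixes z :: "('n::finite, 'm::finite) iterate"
  shows "(norm z)\<^sup>2 = (norm (x_of z))\<^sup>2 + (norm (lam_of z))\<^sup>2 + (norm (muL_of z))\<^sup>2 + (norm (muR_of z))\<^sup>2"
  by (simp add: power2_norm_eq_inner inner_iterate)

lemma norm_sel_le:
  fixes z :: "('n::finite, 'm::finite) iterate"
  shows "norm (x_of z) \<le> norm z" "norm (muL_of z) \<le> norm z" "norm (muR_of z) \<le> norm z"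
  by (rule power2_le_imp_le; simp add: norm_iterate)+

lemma abs_sel_le:
  fixes z :: "('n::finite, 'm::finite) iterate"
  shows "\<bar>x_of z $ i\<bar> \<le> norm z" "\<bar>muL_of z $ i\<bar> \<le> norm z" "\<bar>muR_of z $ i\<bar> \<le> norm z"
  using norm_sel_le[of z] component_le_norm_cart order_trans by blast+

section \<open>The Jacobian and the quadratic remainder\<close>

lemma block_row_mult:
  fixes z :: "('n::finite, 'm::finite) iterate"
  shows "block_row M1 M2 M3 M4 *v z
    = M1 *v x_of z + M2 *v lam_of z + M3 *v muL_of z + M4 *v muR_of z"
  by (simp add: vec_eq_iff matrix_vector_mult_def block_row_def stack4_def sum_iterate
      x_of_def lam_of_def muL_of_def muR_of_def)

lemma stack4_mult:
  fixes z :: "('n::finite, 'm::finite) iterate"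
  shows "stack4 R1 R2 R3 R4 *v z = stack4 (R1 *v z) (R2 *v z) (R3 *v z) (R4 *v z)"
  by (auto simp: vec_eq_iff matrix_vector_mult_def stack4_def split: sum.split)

lemma mat_mult_vec: "mat k *v (v :: real ^ 'n) = k *\<^sub>R v"
  by (auto simp: vec_eq_iff matrix_vector_mult_def mat_def if_distrib[where f = "\<lambda>a. a * _"] cong: if_cong)

lemma diag_mult_vec: "diag u *v v = u * v"
  by (auto simp: vec_eq_iff matrix_vector_mult_def diag_def if_distrib[where f = "\<lambda>a. a * _"] cong: if_cong)

lemma minus_matrix_mult_vec: "(- M) *v v = - (M *v (v :: real ^ 'n))"
  by (simp add: vec_eq_iff matrix_vector_mult_def sum_negf)

lemma DF_mult:
  "DF Q A \<omega> z *v d = stack4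
     (Q *v x_of d + \<omega> *\<^sub>R x_of d - transpose A *v lam_of d - muL_of d + muR_of d)
     (A *v x_of d + \<omega> *\<^sub>R lam_of d)
     (muL_of z * x_of d + (1 + x_of z) * muL_of d)
     (- (muR_of z * x_of d) + (1 - x_of z) * muR_of d)"
  by (simp add: DF_def stack4_mult block_row_mult matrix_vector_mult_add_rdistrib mat_mult_vec
      diag_mult_vec minus_matrix_mult_vec)

text \<open>
  The quadratic part of \<open>F\<close>. It is at the same time the residual left by an exact Newton
  step \<open>d\<close>.
\<close>

definition newton_remainder :: "('n::finite, 'm::finite) iterate \<Rightarrow> ('n, 'm) iterate" where
  "newton_remainder d = stack4 0 0 (muL_of d * x_of d) (- (muR_of d * x_of d))"

lemma F_expansion:
  "F Q c A b \<omega> \<tau> (z + d) = F Q c A b \<omega> \<tau> z + DF Q A \<omega> z *v d + newton_remainder d"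
  unfolding F_def DF_mult newton_remainder_def
  by (rule iterate_eqI; simp add: algebra_simps matrix_vector_right_distrib)

lemma norm_vec_mult_le: "norm (u * v) \<le> norm u * norm (v :: real ^ 'n)"
proof -
  have "norm (u * v) \<le> (\<Sum>i\<in>UNIV. \<bar>u $ i\<bar> * \<bar>v $ i\<bar>)"
    using norm_le_l1_cart[of "u * v"] by (simp add: abs_mult)
  also have "\<dots> \<le> norm u * norm v"
    using L2_set_mult_ineq[of "\<lambda>i. u $ i" "\<lambda>i. v $ i" UNIV] by (simp add: norm_vec_def L2_set_def)
  finally show ?thesis .
qed

lemma norm_stack4_00: "norm (stack4 0 0 u v :: ('n::finite, 'm::finite) iterate) = norm (u, v)"
  by (simp add: norm_Pair norm_eq_sqrt_inner inner_iterate)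

lemma newton_remainder_diff_le:
  "norm (newton_remainder d - newton_remainder e) \<le> 2 * (norm d + norm e) * norm (d - e)"
proof -
  have row: "norm (u * x - v * y) \<le> (norm d + norm e) * norm (d - e)"
    if "norm u \<le> norm d" "norm y \<le> norm e" "norm (u - v) \<le> norm (d - e)" "norm (x - y) \<le> norm (d - e)"
    for u x v y :: "real ^ 'a"
  proof -
    have "u * x - v * y = u * (x - y) + (u - v) * y" by (simp add: algebra_simps)
    then have "norm (u * x - v * y) \<le> norm u * norm (x - y) + norm (u - v) * norm y"
      by (metis norm_triangle_le add_mono norm_vec_mult_le)
    also have "\<dots> \<le> norm d * norm (d - e) + norm (d - e) * norm e"
      using that by (intro add_mono mult_mono) auto
    finally show ?thesis by (simp add: algebra_simps)
  qed
  have "newton_remainder d - newton_remainder e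
    = stack4 0 0 (muL_of d * x_of d - muL_of e * x_of e) (- (muR_of d * x_of d - muR_of e * x_of e))"
    unfolding newton_remainder_def by (rule iterate_eqI) simp_all
  then have "norm (newton_remainder d - newton_remainder e)
      \<le> norm (muL_of d * x_of d - muL_of e * x_of e) + norm (muR_of d * x_of d - muR_of e * x_of e)"
    using norm_Pair_le[of "muL_of d * x_of d - muL_of e * x_of e"] by (metis norm_minus_cancel norm_stack4_00)
  moreover have "norm (muL_of d * x_of d - muL_of e * x_of e) \<le> (norm d + norm e) * norm (d - e)"
    by (rule row) (use norm_sel_le[of d] norm_sel_le[of e] norm_sel_le[of "d - e"] in auto)
  moreover have "norm (muR_of d * x_of d - muR_of e * x_of e) \<le> (norm d + norm e) * norm (d - e)"
    by (rule row) (use norm_sel_le[of d] norm_sel_le[of e] norm_sel_le[of "d - e"] in auto)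
  ultimately show ?thesis by linarith
qed

section \<open>Bounds on the neighbourhoods\<close>

lemma infnorm_less_1_iff: "infnorm (x :: real ^ 'n) < 1 \<longleftrightarrow> (\<forall>i. \<bar>x $ i\<bar> < 1)"
proof
  show "infnorm x < 1 \<Longrightarrow> \<forall>i. \<bar>x $ i\<bar> < 1"
    using component_le_infnorm_cart le_less_trans by blast
  have "finite (range (\<lambda>i. \<bar>x $ i\<bar>))" by simp
  then have "Sup (range (\<lambda>i. \<bar>x $ i\<bar>)) \<in> range (\<lambda>i. \<bar>x $ i\<bar>)"
    by (metis Max_in UNIV_not_empty cSup_eq_Max image_is_empty)
  then have "infnorm x \<in> range (\<lambda>i. \<bar>x $ i\<bar>)"
    by (simp add: infnorm_cart full_SetCompr_eq)
  then show "\<forall>i. \<bar>x $ i\<bar> < 1 \<Longrightarrow> infnorm x < 1" by auto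
qed

lemma nbhd_iff:
  "z \<in> nbhd Q c A b \<omega> \<theta> \<tau> \<longleftrightarrow>
    x_of (F Q c A b \<omega> \<tau> z) = 0 \<and> lam_of (F Q c A b \<omega> \<tau> z) = 0 \<and>
    norm (muL_of z * (1 + x_of z) - \<tau> *\<^sub>R 1, muR_of z * (1 - x_of z) - \<tau> *\<^sub>R 1) \<le> \<theta> * \<tau> \<and>
    (\<forall>i. \<bar>x_of z $ i\<bar> < 1 \<and> 0 < muL_of z $ i \<and> 0 < muR_of z $ i)"
  by (auto simp: nbhd_def infnorm_less_1_iff F_def stack4_eq_iff)

lemma norm_mult_vec_le: "norm (M *v v) \<le> spectral_norm M * norm (v :: real ^ 'n)"
  unfolding spectral_norm_def by (rule onorm) simp

lemma spectral_norm_nonneg: "0 \<le> spectral_norm M"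
  unfolding spectral_norm_def by (rule onorm_pos_le) simp

lemma inner_transpose_mult_vec: "u \<bullet> (transpose M *v w) = w \<bullet> (M *v (u :: real ^ 'n))"
  by (metis dot_lmul_matrix inner_commute transpose_matrix_vector)

lemma norm_transpose_mult_vec_le: "norm (transpose M *v v) \<le> spectral_norm M * norm v"
proof -
  let ?w = "transpose M *v v"
  have "(norm ?w)\<^sup>2 = (M *v ?w) \<bullet> v"
    by (metis inner_transpose_mult_vec inner_commute power2_norm_eq_inner)
  also have "\<dots> \<le> norm (M *v ?w) * norm v" by (rule norm_cauchy_schwarz)
  also have "\<dots> \<le> (spectral_norm M * norm ?w) * norm v"
    by (intro mult_right_mono norm_mult_vec_le) auto
  finally have "norm ?w * norm ?w \<le> norm ?w * (spectral_norm M * norm v)"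
    by (simp add: power2_eq_square algebra_simps)
  then show ?thesis
    by (cases "?w = 0") (auto simp: spectral_norm_nonneg)
qed

lemma nbhd_mono: "\<theta> \<le> \<theta>' \<Longrightarrow> 0 \<le> \<tau> \<Longrightarrow> nbhd Q c A b \<omega> \<theta> \<tau> \<subseteq> nbhd Q c A b \<omega> \<theta>' \<tau>"
  unfolding nbhd_iff subset_iff by (meson mult_right_mono order_trans)

lemma nbhd_component:
  assumes "z \<in> nbhd Q c A b \<omega> \<theta> \<tau>"
  shows "\<bar>muL_of z $ i * (1 + x_of z $ i) - \<tau>\<bar> \<le> \<theta> * \<tau>" "\<bar>muR_of z $ i * (1 - x_of z $ i) - \<tau>\<bar> \<le> \<theta> * \<tau>"
    "\<bar>x_of z $ i\<bar> < 1" "0 < muL_of z $ i" "0 < muR_of z $ i"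
proof -
  have *: "\<bar>u $ i\<bar> \<le> \<theta> * \<tau>" "\<bar>v $ i\<bar> \<le> \<theta> * \<tau>" if "norm (u, v) \<le> \<theta> * \<tau>" for u v :: "real ^ 'a"
    using that component_le_norm_cart[of u i] component_le_norm_cart[of v i]
      norm_fst_le[of u v] norm_snd_le[of v u] by auto
  show "\<bar>muL_of z $ i * (1 + x_of z $ i) - \<tau>\<bar> \<le> \<theta> * \<tau>" "\<bar>muR_of z $ i * (1 - x_of z $ i) - \<tau>\<bar> \<le> \<theta> * \<tau>"
    using assms *[of "muL_of z * (1 + x_of z) - \<tau> *\<^sub>R 1" "muR_of z * (1 - x_of z) - \<tau> *\<^sub>R 1"]
    by (simp_all add: nbhd_iff)
  show "\<bar>x_of z $ i\<bar> < 1" "0 < muL_of z $ i" "0 < muR_of z $ i"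
    using assms by (simp_all add: nbhd_iff)
qed

text \<open>
  The second block row bounds \<open>\<lambda>\<close>, the first one bounds \<open>\<mu>\<^sub>L - \<mu>\<^sub>R\<close>. Of each pair
  \<open>\<mu>\<^sub>L i\<close>, \<open>\<mu>\<^sub>R i\<close>, the multiplier whose slack \<open>1 \<plusminus> x i\<close> is at least \<open>1\<close> is bounded by
  the complementarity product \<open>(1 + \<theta>) \<tau>\<close>; the difference then bounds the other one.
\<close>

lemma nbhd_norm_le:
  assumes z: "z \<in> nbhd Q c A b \<omega> \<theta> \<tau>" and pos: "0 < \<omega>" "0 \<le> \<theta>" "0 < \<tau>" "\<tau> \<le> T"
    and lam: "(spectral_norm A * sqrt (real CARD('n)) + norm b) / \<omega> \<le> C_lam"
    and dmu: "(\<omega> + spectral_norm Q) * sqrt (real CARD('n)) + norm c + spectral_norm A * C_lam \<le> C_d"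
    and mu: "sqrt (2 * real CARD('n)) * (C_d + (1 + \<theta>) * T) \<le> C_mu"
  shows "norm (z :: ('n::finite, 'm::finite) iterate) \<le> sqrt (real CARD('n) + C_lam\<^sup>2 + C_mu\<^sup>2)"
proof (rule real_le_rsqrt)
  let ?n = "real CARD('n)"
  note comp = nbhd_component[OF z]
  have "infnorm (x_of z) \<le> 1" using comp(3) infnorm_less_1_iff less_imp_le by blast
  then have x: "norm (x_of z) \<le> sqrt ?n"
    using norm_le_infnorm[of "x_of z"] by (simp add: mult_left_le order_trans)
  have "A *v x_of z - b + \<omega> *\<^sub>R lam_of z = 0" using z by (simp add: nbhd_iff F_def)
  then have "\<omega> *\<^sub>R lam_of z = b - A *v x_of z" by (simp add: algebra_simps eq_neg_iff_add_eq_0)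
  then have "\<omega> * norm (lam_of z) = norm (b - A *v x_of z)" using pos by (metis norm_scaleR abs_of_pos)
  also have "\<dots> \<le> norm b + norm (A *v x_of z)" by (rule norm_triangle_ineq4)
  also have "\<dots> \<le> norm b + spectral_norm A * sqrt ?n"
    using norm_mult_vec_le[of A "x_of z"] mult_left_mono[OF x spectral_norm_nonneg[of A]] by linarith
  finally have lam_le: "norm (lam_of z) \<le> C_lam"
    using lam pos by (smt (verit) divide_le_eq le_divide_eq mult.commute)
  have "x_of (F Q c A b \<omega> \<tau> z) = 0" using z by (simp add: nbhd_iff)
  then have "muL_of z - muR_of z = Q *v x_of z + \<omega> *\<^sub>R x_of z + c - transpose A *v lam_of z"
    by (simp add: F_def algebra_simps)
  then have "norm (muL_of z - muR_of z)
      \<le> norm (Q *v x_of z) + norm (\<omega> *\<^sub>R x_of z) + norm c + norm (transpose A *v lam_of z)"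
    using norm_triangle_ineq[of "Q *v x_of z" "\<omega> *\<^sub>R x_of z"]
      norm_triangle_ineq[of "Q *v x_of z + \<omega> *\<^sub>R x_of z" c]
      norm_triangle_ineq4[of "Q *v x_of z + \<omega> *\<^sub>R x_of z + c" "transpose A *v lam_of z"] by simp
  also have "norm (Q *v x_of z) \<le> spectral_norm Q * sqrt ?n"
    using norm_mult_vec_le[of Q "x_of z"] mult_left_mono[OF x spectral_norm_nonneg[of Q]] by linarith
  also have "norm (\<omega> *\<^sub>R x_of z) \<le> \<omega> * sqrt ?n" using x pos by simp
  also have "norm (transpose A *v lam_of z) \<le> spectral_norm A * C_lam"
    using norm_transpose_mult_vec_le[of A "lam_of z"]
      mult_left_mono[OF lam_le spectral_norm_nonneg[of A]] by linarith
  finally have diff: "norm (muL_of z - muR_of z) \<le> C_d" using dmu by (simp add: algebra_simps)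
  then have C_d: "0 \<le> C_d" using norm_ge_zero order_trans by blast
  define K where "K = C_d + (1 + \<theta>) * T"
  have mu_le: "muL_of z $ i \<le> K \<and> muR_of z $ i \<le> K" for i
  proof -
    have d: "\<bar>muL_of z $ i - muR_of z $ i\<bar> \<le> C_d"
      using diff component_le_norm_cart[of "muL_of z - muR_of z" i] by simp
    have t: "\<tau> + \<theta> * \<tau> \<le> (1 + \<theta>) * T"
      using mult_left_mono[OF pos(4), of "1 + \<theta>"] pos by (simp add: algebra_simps)
    show ?thesis
    proof (cases "0 \<le> x_of z $ i")
      case True
      then have "muL_of z $ i \<le> muL_of z $ i * (1 + x_of z $ i)" using comp(4)[of i] by simp
      then show ?thesis using comp(1)[of i] d t C_d unfolding K_def by linarith
    next
      case False
      then have "muR_of z $ i \<le> muR_of z $ i * (1 - x_of z $ i)" using comp(5)[of i] by simp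
      then show ?thesis using comp(2)[of i] d t C_d unfolding K_def by linarith
    qed
  qed
  have sq: "(norm v)\<^sup>2 \<le> ?n * K\<^sup>2" if "\<And>i. 0 \<le> v $ i \<and> v $ i \<le> K" for v :: "real ^ 'n"
  proof -
    have "(norm v)\<^sup>2 = (\<Sum>i\<in>UNIV. (v $ i)\<^sup>2)"
      unfolding power2_norm_eq_inner inner_vec_def by (simp add: power2_eq_square)
    also have "\<dots> \<le> (\<Sum>i\<in>(UNIV::'n set). K\<^sup>2)" using that by (intro sum_mono power_mono) auto
    finally show ?thesis by simp
  qed
  have "(norm (muL_of z))\<^sup>2 \<le> ?n * K\<^sup>2" "(norm (muR_of z))\<^sup>2 \<le> ?n * K\<^sup>2"
    using mu_le comp(4,5) by (simp_all add: sq less_imp_le)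
  then have "(norm (muL_of z))\<^sup>2 + (norm (muR_of z))\<^sup>2 \<le> (sqrt (2 * ?n) * K)\<^sup>2"
    by (simp add: power_mult_distrib)
  also have "\<dots> \<le> C_mu\<^sup>2"
    using mu C_d pos by (intro power_mono) (auto simp: K_def)
  finally have "(norm (muL_of z))\<^sup>2 + (norm (muR_of z))\<^sup>2 \<le> C_mu\<^sup>2" .
  moreover have "(norm (x_of z))\<^sup>2 \<le> ?n" using power_mono[OF x, of 2] by simp
  moreover have "(norm (lam_of z))\<^sup>2 \<le> C_lam\<^sup>2" using power_mono[OF lam_le, of 2] by simp
  ultimately show "(norm z)\<^sup>2 \<le> ?n + C_lam\<^sup>2 + C_mu\<^sup>2" by (simp add: norm_iterate)
qed

lemma nbhd_gap:
  assumes z: "z \<in> nbhd Q c A b \<omega> \<theta> \<tau>" and "norm z \<le> C"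
  shows "(1 - \<theta>) * \<tau> / 2 \<le> muL_of z $ i" "(1 - \<theta>) * \<tau> / 2 \<le> muR_of z $ i"
    "(1 - \<theta>) * \<tau> \<le> C * (1 + x_of z $ i)" "(1 - \<theta>) * \<tau> \<le> C * (1 - x_of z $ i)"
proof -
  note comp = nbhd_component[OF z, of i]
  have prod: "(1 - \<theta>) * \<tau> \<le> m * s \<Longrightarrow> 0 < m \<Longrightarrow> m \<le> C \<Longrightarrow> 0 < s \<Longrightarrow> s < 2
      \<Longrightarrow> (1 - \<theta>) * \<tau> / 2 \<le> m \<and> (1 - \<theta>) * \<tau> \<le> C * s" for m s :: real
    using mult_right_mono[of m C s] mult_left_mono[of s 2 m] by linarith
  have "(1 - \<theta>) * \<tau> / 2 \<le> muL_of z $ i \<and> (1 - \<theta>) * \<tau> \<le> C * (1 + x_of z $ i)"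
    using comp abs_sel_le(2)[of z i] assms(2) by (intro prod) (auto simp: algebra_simps)
  moreover have "(1 - \<theta>) * \<tau> / 2 \<le> muR_of z $ i \<and> (1 - \<theta>) * \<tau> \<le> C * (1 - x_of z $ i)"
    using comp abs_sel_le(3)[of z i] assms(2) by (intro prod) (auto simp: algebra_simps)
  ultimately show "(1 - \<theta>) * \<tau> / 2 \<le> muL_of z $ i" "(1 - \<theta>) * \<tau> / 2 \<le> muR_of z $ i"
    "(1 - \<theta>) * \<tau> \<le> C * (1 + x_of z $ i)" "(1 - \<theta>) * \<tau> \<le> C * (1 - x_of z $ i)" by auto
qed

section \<open>The inverse of the Jacobian\<close>

text \<open>
  With \<open>s\<close> the right-hand side after division of its last two blocks by \<open>\<mu>\<^sub>L\<close> and \<open>\<mu>\<^sub>R\<close>, the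
  off-diagonal blocks cancel in \<open>d \<bullet> s\<close>, which leaves
  \<open>norm d\<^sup>2 \<le> K * (d \<bullet> s)\<close> for \<open>K = max (1 / \<omega>) (C / g)\<close>, while \<open>norm s \<le> norm (DF z d) / g\<close>.
\<close>

lemma DF_inverse_bound:
  fixes z d :: "('n::finite, 'm::finite) iterate"
  assumes psd: "\<And>v. 0 \<le> v \<bullet> (Q *v v)" and \<omega>: "0 < \<omega>"
    and g: "0 < g" "g \<le> 1"
    and x: "\<And>i. g \<le> 1 + x_of z $ i" "\<And>i. g \<le> 1 - x_of z $ i"
    and mu: "\<And>i. g \<le> muL_of z $ i" "\<And>i. g \<le> muR_of z $ i"
      "\<And>i. muL_of z $ i \<le> C" "\<And>i. muR_of z $ i \<le> C"
  shows "norm d \<le> 1 / g * max (1 / \<omega>) (C / g) * norm (DF Q A \<omega> z *v d)"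
proof -
  define r where "r = DF Q A \<omega> z *v d"
  define K where "K = max (1 / \<omega>) (C / g)"
  have K: "0 < K" "1 / \<omega> \<le> K" "C / g \<le> K" using \<omega> by (auto simp: K_def less_max_iff_disj)
  define pL where "pL = (\<chi> i. (1 + x_of z $ i) / muL_of z $ i)"
  define pR where "pR = (\<chi> i. (1 - x_of z $ i) / muR_of z $ i)"
  define s where "s = stack4 (x_of r) (lam_of r) (x_of d + pL * muL_of d) (- x_of d + pR * muR_of d)"
  have mu0: "0 < muL_of z $ i" "0 < muR_of z $ i" for i using mu g by (meson less_le_trans)+
  have ratio: "1 \<le> K * (y / m)" if "g \<le> y" "0 < m" "m \<le> C" for y m
  proof -
    have "m \<le> K * g" using that K(3) g by (simp add: divide_le_eq)
    also have "\<dots> \<le> K * y" using that K by simp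
    finally show ?thesis using that by simp
  qed
  have pL: "(norm (muL_of d))\<^sup>2 \<le> K * (muL_of d \<bullet> (pL * muL_of d))"
    unfolding power2_norm_eq_inner inner_vec_def sum_distrib_left
  proof (rule sum_mono)
    fix i
    show "muL_of d $ i \<bullet> muL_of d $ i \<le> K * (muL_of d $ i \<bullet> (pL * muL_of d) $ i)"
      using mult_right_mono[OF ratio[OF x(1) mu0(1) mu(3)], of "(muL_of d $ i)\<^sup>2" i]
      by (simp add: pL_def power2_eq_square algebra_simps)
  qed
  have pR: "(norm (muR_of d))\<^sup>2 \<le> K * (muR_of d \<bullet> (pR * muR_of d))"
    unfolding power2_norm_eq_inner inner_vec_def sum_distrib_left
  proof (rule sum_mono)
    fix i
    show "muR_of d $ i \<bullet> muR_of d $ i \<le> K * (muR_of d $ i \<bullet> (pR * muR_of d) $ i)"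
      using mult_right_mono[OF ratio[OF x(2) mu0(2) mu(4)], of "(muR_of d $ i)\<^sup>2" i]
      by (simp add: pR_def power2_eq_square algebra_simps)
  qed
  have "K * \<omega> \<ge> 1" using K(2) \<omega> by (simp add: divide_le_eq)
  then have diag_bound: "q \<le> K * (\<omega> * q)" if "0 \<le> q" for q
    using mult_right_mono[of 1 "K * \<omega>" q] that by (simp add: mult.assoc)
  have "d \<bullet> s = x_of d \<bullet> (Q *v x_of d) + \<omega> * (norm (x_of d))\<^sup>2 + \<omega> * (norm (lam_of d))\<^sup>2
      + muL_of d \<bullet> (pL * muL_of d) + muR_of d \<bullet> (pR * muR_of d)"
    unfolding inner_iterate s_def r_def DF_mult
    by (simp add: inner_simps power2_norm_eq_inner inner_transpose_mult_vec
        inner_commute[of "x_of d" "muL_of d"] inner_commute[of "x_of d" "muR_of d"]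
        del: transpose_matrix_vector)
  moreover have "0 \<le> K * (x_of d \<bullet> (Q *v x_of d))" using psd K by simp
  ultimately have "(norm d)\<^sup>2 \<le> K * (d \<bullet> s)"
    using diag_bound[of "(norm (x_of d))\<^sup>2"] diag_bound[of "(norm (lam_of d))\<^sup>2"] pL pR
    by (simp add: norm_iterate distrib_left)
  also have "\<dots> \<le> K * (norm d * norm s)"
    using K norm_cauchy_schwarz by (intro mult_left_mono) auto
  finally have "norm d * norm d \<le> norm d * (K * norm s)"
    by (simp add: power2_eq_square mult.left_commute)
  then have "norm d \<le> K * norm s"
    using K by (cases "d = 0") auto
  moreover have "norm s \<le> norm r / g"
  proof (rule power2_le_imp_le)
    have *: "\<bar>u\<bar> \<le> \<bar>v\<bar> / g" if "m * u = v" "g \<le> m" for u v m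
      using that g by (simp add: le_divide_eq abs_mult flip: that(1)) (metis abs_ge_self abs_ge_zero mult.commute mult_right_mono order_trans)
    have comp: "norm u \<le> norm v / g" if "\<And>i. m $ i * u $ i = v $ i" "\<And>i. g \<le> m $ i"
      for u v m :: "real ^ 'k::finite"
      using norm_le_componentwise_cart[of u "(1 / g) *\<^sub>R v"] *[OF that] g by (simp add: abs_mult)
    have "norm (muL_of s) \<le> norm (muL_of r) / g"
      using mu by (intro comp[of "muL_of z"])
        (use mu0(1) in \<open>simp_all add: s_def pL_def r_def DF_mult field_simps less_imp_neq[THEN not_sym]\<close>)
    moreover have "norm (muR_of s) \<le> norm (muR_of r) / g"
      using mu by (intro comp[of "muR_of z"])
        (use mu0(2) in \<open>simp_all add: s_def pR_def r_def DF_mult field_simps less_imp_neq[THEN not_sym]\<close>)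
    moreover have "norm (x_of s) \<le> norm (x_of r) / g" "norm (lam_of s) \<le> norm (lam_of r) / g"
      using g by (simp_all add: s_def le_divide_eq mult_left_le)
    ultimately have "(norm s)\<^sup>2 \<le> (norm (x_of r) / g)\<^sup>2 + (norm (lam_of r) / g)\<^sup>2
        + (norm (muL_of r) / g)\<^sup>2 + (norm (muR_of r) / g)\<^sup>2"
      unfolding norm_iterate[of s] by (intro add_mono power_mono) auto
    also have "\<dots> = (norm r / g)\<^sup>2" by (simp add: power_divide norm_iterate add_divide_distrib)
    finally show "(norm s)\<^sup>2 \<le> (norm r / g)\<^sup>2" .
  qed (use g in simp)
  then have "K * norm s \<le> K * (norm r / g)" using K by (intro mult_left_mono) auto
  ultimately show ?thesis unfolding r_def K_def by simp
qed

text \<open>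
  The second conclusion holds because \<open>1 + x\<close> and \<open>1 - x\<close> add up to \<open>2\<close> and each is at
  least \<open>2 g\<close> at \<open>z\<^sub>0\<close>.
\<close>

lemma DF_inverse_bound_near_nbhd:
  fixes z d :: "('n::finite, 'm::finite) iterate"
  assumes z0: "z0 \<in> nbhd Q c A b \<omega> \<theta> \<tau>" "norm z0 + \<delta> \<le> C" and near: "norm (z - z0) \<le> \<delta>" "\<delta> \<le> g"
    and psd: "\<And>v. 0 \<le> v \<bullet> (Q *v v)" and pos: "0 < \<omega>" "1 \<le> C" "0 < g"
    and gap: "2 * (1 + C) * g \<le> (1 - \<theta>) * \<tau>"
  shows "norm d \<le> 1 / g * max (1 / \<omega>) (C / g) * norm (DF Q A \<omega> z *v d)" and "g \<le> 1 / 2"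
proof -
  have "norm z0 \<le> C" using z0 near norm_ge_zero[of "z - z0"] by linarith
  note g0 = nbhd_gap[OF z0(1) this]
  have slack: "2 * g \<le> s" if "(1 - \<theta>) * \<tau> \<le> C * s" for s
  proof -
    have "C * (2 * g) \<le> 2 * (1 + C) * g" using pos by (simp add: algebra_simps)
    also have "\<dots> \<le> C * s" using that gap by simp
    finally have "C * (2 * g) \<le> C * s" .
    then show ?thesis using pos by simp
  qed
  have x0: "2 * g \<le> 1 + x_of z0 $ i" "2 * g \<le> 1 - x_of z0 $ i" for i using slack g0(3,4) by auto
  show "g \<le> 1 / 2" using x0[of undefined] by linarith
  have "g \<le> C * g" using pos by simp
  then have mu0: "2 * g \<le> muL_of z0 $ i" "2 * g \<le> muR_of z0 $ i" for i
    using g0(1,2)[of i] gap by (simp_all add: algebra_simps)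
  have dist: "\<bar>x_of z $ i - x_of z0 $ i\<bar> \<le> g" "\<bar>muL_of z $ i - muL_of z0 $ i\<bar> \<le> g"
    "\<bar>muR_of z $ i - muR_of z0 $ i\<bar> \<le> g" for i
    using abs_sel_le[of "z - z0" i] near by simp_all
  have "norm z \<le> C" using norm_triangle_sub[of z z0] near z0 by linarith
  then have "muL_of z $ i \<le> C" "muR_of z $ i \<le> C" for i using abs_sel_le[of z i] by linarith+
  moreover have "g \<le> 1 + x_of z $ i" "g \<le> 1 - x_of z $ i" "g \<le> muL_of z $ i" "g \<le> muR_of z $ i" for i
    using x0[of i] mu0[of i] dist[of i] by linarith+
  ultimately show "norm d \<le> 1 / g * max (1 / \<omega>) (C / g) * norm (DF Q A \<omega> z *v d)"
    using \<open>g \<le> 1 / 2\<close> pos by (intro DF_inverse_bound psd) auto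
qed

lemma invertible_if_bounded_below:
  fixes M :: "real ^ 'n ^ 'n"
  assumes "\<And>v. norm v \<le> K * norm (M *v v)"
  shows "invertible M"
proof -
  have "v = 0" if "M *v v = 0" for v using assms[of v] that by simp
  then show ?thesis using matrix_left_invertible_ker invertible_left_inverse by blast
qed

lemma mult_minus_vec: "M *v (- v) = - (M *v (v :: real ^ 'n))"
  by (simp add: vec_eq_iff matrix_vector_mult_def sum_negf)

lemma matrix_inv_solves:
  fixes M :: "real ^ 'n ^ 'n"
  assumes "invertible M"
  shows "M *v (- (matrix_inv M *v r)) = - r"
proof -
  have "M ** matrix_inv M = mat 1"
    using someI_ex[OF assms[unfolded invertible_def]] unfolding matrix_inv_def by blast
  then show ?thesis by (simp add: matrix_vector_mul_assoc mult_minus_vec)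
qed

section \<open>The Newton step\<close>

text \<open>
  For one complementarity pair (multiplier \<open>m\<close>, slack \<open>s\<close>) and its Newton direction, the
  inequality of arithmetic and geometric means bounds the product of the increments. The
  signed term \<open>2 * (dm * ds)\<close> is kept because it is only controlled after summation.
\<close>

lemma linearized_product_le:
  fixes m s dm ds r \<mu> :: real
  assumes "m * ds + s * dm = - r" "0 < \<mu>" "\<mu> \<le> m * s"
  shows "2 * \<bar>dm * ds\<bar> + 2 * (dm * ds) \<le> r\<^sup>2 / \<mu>"
proof -
  let ?p = "dm * ds"
  have "r\<^sup>2 = (m * ds + s * dm)\<^sup>2" using assms(1) by (simp add: power2_eq_square)
  also have "\<dots> = (m * ds)\<^sup>2 + (s * dm)\<^sup>2 + 2 * (m * s) * ?p" by (simp add: power2_eq_square algebra_simps)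
  finally have "r\<^sup>2 = (m * ds)\<^sup>2 + (s * dm)\<^sup>2 + 2 * (m * s) * ?p" .
  moreover have "2 * (m * s) * \<bar>?p\<bar> \<le> (m * ds)\<^sup>2 + (s * dm)\<^sup>2"
  proof -
    have "2 * (m * s) * \<bar>?p\<bar> = 2 * \<bar>m * s\<bar> * \<bar>?p\<bar>" using assms by simp
    also have "\<dots> = 2 * \<bar>m * ds\<bar> * \<bar>s * dm\<bar>" by (simp add: abs_mult)
    also have "\<dots> \<le> (m * ds)\<^sup>2 + (s * dm)\<^sup>2"
      using sum_squares_bound[of "\<bar>m * ds\<bar>" "\<bar>s * dm\<bar>"] by simp
    finally show ?thesis .
  qed
  moreover have "(m * s) * (2 * \<bar>?p\<bar> + 2 * ?p) = 2 * (m * s) * \<bar>?p\<bar> + 2 * (m * s) * ?p"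
    by (simp only: distrib_left ac_simps)
  ultimately have "(m * s) * (2 * \<bar>?p\<bar> + 2 * ?p) \<le> r\<^sup>2" by linarith
  moreover have "\<mu> * (2 * \<bar>?p\<bar> + 2 * ?p) \<le> (m * s) * (2 * \<bar>?p\<bar> + 2 * ?p)"
    using assms by (intro mult_right_mono) auto
  ultimately show ?thesis using assms by (simp add: le_divide_eq mult.commute)
qed

text \<open>
  After the full step the product \<open>(m + dm) (s + ds) = \<tau> + dm ds\<close> is positive. The
  linearization excludes two negative factors, so no continuity argument along the step is
  needed.
\<close>

lemma factors_pos:
  fixes m s dm ds r \<tau> :: real
  assumes "m * ds + s * dm = - r" "r = m * s - \<tau>" "\<bar>r\<bar> \<le> \<tau>" "\<bar>dm * ds\<bar> < \<tau>" "0 < m" "0 < s"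
  shows "0 < m + dm" "0 < s + ds"
proof -
  have 1: "(m + dm) * (s + ds) = \<tau> + dm * ds" using assms by (simp add: algebra_simps)
  have pos: "0 < (m + dm) * (s + ds)" using assms unfolding 1 by linarith
  have 2: "m * (s + ds) + s * (m + dm) = 2 * \<tau> + r" using assms by (simp add: algebra_simps)
  have "\<not> (m + dm < 0 \<and> s + ds < 0)"
  proof
    assume neg: "m + dm < 0 \<and> s + ds < 0"
    then have "m * (s + ds) < 0" "s * (m + dm) < 0" using assms by (simp_all add: mult_pos_neg)
    then show False using 2 assms by linarith
  qed
  then show "0 < m + dm" "0 < s + ds" using pos by (auto simp: zero_less_mult_iff)
qed

text \<open>
  A full exact Newton step with unchanged \<open>\<tau>\<close> halves the radius factor of the neighbourhood,
  as long as that factor is at most \<open>1 / 2\<close>.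
\<close>

lemma newton_step_mem_nbhd:
  fixes z d :: "('n::finite, 'm::finite) iterate"
  assumes z: "z \<in> nbhd Q c A b \<omega> \<theta> \<tau>" and d: "DF Q A \<omega> z *v d = - F Q c A b \<omega> \<tau> z"
    and psd: "\<And>v. 0 \<le> v \<bullet> (Q *v v)" and pos: "0 < \<omega>" "0 < \<theta>" "\<theta> \<le> 1/2" "0 < \<tau>"
  shows "z + d \<in> nbhd Q c A b \<omega> (0.5 * \<theta>) \<tau>"
proof -
  note comp = nbhd_component[OF z]
  define rL where "rL = muL_of z * (1 + x_of z) - \<tau> *\<^sub>R 1"
  define rR where "rR = muR_of z * (1 - x_of z) - \<tau> *\<^sub>R 1"
  define pL where "pL = muL_of d * x_of d"
  define pR where "pR = - (muR_of d * x_of d)"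
  define \<mu> where "\<mu> = (1 - \<theta>) * \<tau>"
  have \<mu>: "0 < \<mu>" "\<theta> * \<tau> \<le> \<mu>" using pos by (simp_all add: \<mu>_def)
  have Fz: "F Q c A b \<omega> \<tau> z = stack4 0 0 rL rR" and r: "norm (rL, rR) \<le> \<theta> * \<tau>"
    using z by (auto simp: nbhd_iff rL_def rR_def F_def)
  have rows: "Q *v x_of d + \<omega> *\<^sub>R x_of d - transpose A *v lam_of d - muL_of d + muR_of d = 0"
    "A *v x_of d + \<omega> *\<^sub>R lam_of d = 0"
    "muL_of z * x_of d + (1 + x_of z) * muL_of d = - rL"
    "- (muR_of z * x_of d) + (1 - x_of z) * muR_of d = - rR"
    using arg_cong[OF d, of x_of] arg_cong[OF d, of lam_of] arg_cong[OF d, of muL_of]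
      arg_cong[OF d, of muR_of] by (simp_all add: DF_mult Fz)
  have rowL: "muL_of z $ i * x_of d $ i + (1 + x_of z $ i) * muL_of d $ i = - (rL $ i)" for i
    using arg_cong[OF rows(3), of "\<lambda>v. v $ i"] by simp
  have rowR: "muR_of z $ i * (- x_of d $ i) + (1 - x_of z $ i) * muR_of d $ i = - (rR $ i)" for i
    using arg_cong[OF rows(4), of "\<lambda>v. v $ i"] by simp
  have pL_le: "2 * \<bar>pL $ i\<bar> + 2 * pL $ i \<le> (rL $ i)\<^sup>2 / \<mu>" for i
    using linearized_product_le[OF rowL \<mu>(1), of i] comp(1)[of i]
    by (simp add: pL_def \<mu>_def algebra_simps)
  have pR_le: "2 * \<bar>pR $ i\<bar> + 2 * pR $ i \<le> (rR $ i)\<^sup>2 / \<mu>" for i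
    using linearized_product_le[OF rowR \<mu>(1), of i] comp(2)[of i]
    by (simp add: pR_def \<mu>_def algebra_simps)
  \<comment> \<open>Monotonicity: the first two block rows make the signed sum of all products nonnegative.\<close>
  have "muL_of d - muR_of d = Q *v x_of d + \<omega> *\<^sub>R x_of d - transpose A *v lam_of d"
    using rows(1) by (simp add: algebra_simps)
  then have "x_of d \<bullet> (muL_of d - muR_of d)
      = x_of d \<bullet> (Q *v x_of d) + \<omega> * (x_of d \<bullet> x_of d) - lam_of d \<bullet> (A *v x_of d)"
    by (simp add: inner_add_right inner_diff_right inner_transpose_mult_vec
        del: transpose_matrix_vector)
  also have "A *v x_of d = - \<omega> *\<^sub>R lam_of d" using rows(2) by (simp add: eq_neg_iff_add_eq_0)
  finally have "0 \<le> x_of d \<bullet> (muL_of d - muR_of d)" using psd pos by simp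
  also have "\<dots> = (\<Sum>i\<in>UNIV. pL $ i) + (\<Sum>i\<in>UNIV. pR $ i)"
    by (simp add: inner_vec_def pL_def pR_def algebra_simps sum_subtractf sum_negf)
  finally have sum_nonneg: "0 \<le> (\<Sum>i\<in>UNIV. pL $ i) + (\<Sum>i\<in>UNIV. pR $ i)" .
  have "2 * (\<Sum>i\<in>UNIV. \<bar>pL $ i\<bar>) + 2 * (\<Sum>i\<in>UNIV. pL $ i) \<le> (norm rL)\<^sup>2 / \<mu>"
    using sum_mono[of UNIV, OF pL_le]
    unfolding power2_norm_eq_inner inner_vec_def
    by (simp add: sum.distrib sum_distrib_left power2_eq_square sum_divide_distrib)
  moreover have "2 * (\<Sum>i\<in>UNIV. \<bar>pR $ i\<bar>) + 2 * (\<Sum>i\<in>UNIV. pR $ i) \<le> (norm rR)\<^sup>2 / \<mu>"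
    using sum_mono[of UNIV, OF pR_le]
    unfolding power2_norm_eq_inner inner_vec_def
    by (simp add: sum.distrib sum_distrib_left power2_eq_square sum_divide_distrib)
  moreover have "norm (pL, pR) \<le> (\<Sum>i\<in>UNIV. \<bar>pL $ i\<bar>) + (\<Sum>i\<in>UNIV. \<bar>pR $ i\<bar>)"
    using norm_Pair_le[of pL pR] norm_le_l1_cart[of pL] norm_le_l1_cart[of pR] by simp
  moreover have "((norm rL)\<^sup>2 + (norm rR)\<^sup>2) / \<mu> \<le> \<theta> * \<tau>"
  proof -
    have "(norm rL)\<^sup>2 + (norm rR)\<^sup>2 = (norm (rL, rR))\<^sup>2" by (simp add: norm_Pair)
    also have "\<dots> \<le> (\<theta> * \<tau>) * (\<theta> * \<tau>)" using power_mono[OF r, of 2] by (simp add: power2_eq_square)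
    \<comment> \<open>Here \<open>\<theta> \<le> 1 / 2\<close> enters, in the form \<open>\<theta> * \<tau> \<le> \<mu>\<close>.\<close>
    also have "\<dots> \<le> (\<theta> * \<tau>) * \<mu>" using \<mu> pos by (intro mult_left_mono) auto
    finally show ?thesis using \<mu> by (simp add: divide_le_eq)
  qed
  ultimately have p: "norm (pL, pR) \<le> 0.5 * \<theta> * \<tau>" using sum_nonneg by (simp add: add_divide_distrib)
  have F1: "F Q c A b \<omega> \<tau> (z + d) = stack4 0 0 pL pR"
    using d by (simp add: F_expansion newton_remainder_def pL_def pR_def)
  have small: "0.5 * \<theta> * \<tau> < \<tau>" "\<theta> * \<tau> \<le> \<tau>" using pos by simp_all
  have pL_small: "\<bar>pL $ i\<bar> < \<tau>" and pR_small: "\<bar>pR $ i\<bar> < \<tau>" for i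
    using p small component_le_norm_cart[of pL i] component_le_norm_cart[of pR i]
      norm_fst_le[of pL pR] norm_snd_le[of pR pL] by auto
  have L: "0 < muL_of z $ i + muL_of d $ i" "0 < (1 + x_of z $ i) + x_of d $ i" for i
    using factors_pos[OF rowL, of i \<tau>] comp[of i] pL_small[of i] small by (auto simp: rL_def pL_def)
  have R: "0 < muR_of z $ i + muR_of d $ i" "0 < (1 - x_of z $ i) + (- x_of d $ i)" for i
    using factors_pos[OF rowR, of i \<tau>] comp[of i] pR_small[of i] small by (auto simp: rR_def pR_def)
  have "\<bar>x_of z $ i + x_of d $ i\<bar> < 1" for i using L(2)[of i] R(2)[of i] by linarith
  moreover have "muL_of (F Q c A b \<omega> \<tau> (z + d)) = pL" "muR_of (F Q c A b \<omega> \<tau> (z + d)) = pR"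
    by (simp_all add: F1)
  then have "muL_of (z + d) * (1 + x_of (z + d)) - \<tau> *\<^sub>R 1 = pL"
    "muR_of (z + d) * (1 - x_of (z + d)) - \<tau> *\<^sub>R 1 = pR" unfolding F_def by simp_all
  ultimately show ?thesis unfolding nbhd_iff using p L R by (simp add: F1)
qed

text \<open>
  Expand \<open>F (z\<^sub>0 + d\<^sub>0)\<close> about \<open>z\<^sub>0\<close> and about \<open>z\<close>; the values of \<open>F\<close> cancel and only the
  quadratic remainders survive.
\<close>

lemma newton_step_perturbation:
  assumes "DF Q A \<omega> z0 *v d0 = - F Q c A b \<omega> \<tau> z0" and "DF Q A \<omega> z *v d = - F Q c A b \<omega> \<tau> z"
  shows "DF Q A \<omega> z *v ((z + d) - (z0 + d0)) = newton_remainder ((z0 + d0) - z) - newton_remainder d0"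
proof -
  have "F Q c A b \<omega> \<tau> (z0 + d0) = newton_remainder d0" using assms(1) by (simp add: F_expansion)
  moreover have "F Q c A b \<omega> \<tau> (z0 + d0)
      = F Q c A b \<omega> \<tau> z + DF Q A \<omega> z *v ((z0 + d0) - z) + newton_remainder ((z0 + d0) - z)"
    using F_expansion[of Q c A b \<omega> \<tau> z "(z0 + d0) - z"] by simp
  moreover have "(z + d) - (z0 + d0) = d - ((z0 + d0) - z)" by simp
  ultimately show ?thesis using assms(2)
    by (simp add: matrix_vector_mult_diff_distrib del: add_diff_cancel_left) (simp add: algebra_simps)
qed

section \<open>The inexact corrector step\<close>

theorem theorem4p4:
  fixes Q :: "real ^ 'n ^ 'n" and c :: "real ^ 'n"
    and A :: "real ^ 'n ^ 'm" and b :: "real ^ 'm"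
    and n tol \<theta> \<beta> \<sigma> C_q \<omega> C_lam C_\<Delta>\<mu> \<tau>\<^sub>A \<tau>\<^sub>E C_\<mu> C_z c_gap C_DF C_DFinv \<kappa>_DF
        C_\<delta>F C_\<delta>DF C_\<delta>\<Delta>z C_\<nu> \<nu>\<^sub>0 \<nu>\<^sub>1 \<nu>\<^sub>2 const :: real
  defines "n \<equiv> real CARD('n)"
  assumes "sym_psd Q" and "0 < tol"
    and "0 < \<theta>" "\<theta> \<le> 0.3"
    and "0 < \<beta>" "\<beta> \<le> \<theta>"
    and "0 < \<sigma>" "1 - \<beta> / sqrt (2 * n) \<le> \<sigma>" "\<sigma> < 1"
    and "0 < C_q" "C_q \<ge> spectral_norm Q * n + norm c * sqrt n"
    and "0 < \<omega>" "\<omega> \<le> tol / (2 * n)" "\<omega> \<le> tol\<^sup>2 / (16 * (4 * C_q + n))" "\<omega> \<le> 1"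
    and "0 < C_lam" "C_lam \<ge> (spectral_norm A * sqrt n + norm b) / \<omega>"
    and "0 < C_\<Delta>\<mu>"
        "C_\<Delta>\<mu> \<ge> (\<omega> + spectral_norm Q) * sqrt n + norm c + spectral_norm A * C_lam"
    and "0 < \<tau>\<^sub>A"
        "\<tau>\<^sub>A \<ge> max (1/4 * spectral_norm (Q + mat \<omega> + (1/\<omega>) *\<^sub>R (transpose A ** A)))
                  (4 * norm (c - (1/\<omega>) *\<^sub>R (transpose A *v b)))"
    and "0 < \<tau>\<^sub>E" "\<tau>\<^sub>E \<le> tol\<^sup>2 * \<omega> / (48 * n * max (spectral_norm A) C_q)"
    and "0 < C_\<mu>" "C_\<mu> \<ge> sqrt (2 * n) * (C_\<Delta>\<mu> + (1 + \<theta>) * \<tau>\<^sub>A)"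
    and "0 < C_z" "C_z \<ge> sqrt (n + C_lam\<^sup>2 + C_\<mu>\<^sup>2) + 0.1"
    and "0 < c_gap" "c_gap \<le> (1 - \<theta>) / (1 + C_z) * (\<sigma> * \<tau>\<^sub>E / 2)"
    and "0 < C_DF" "C_DF \<ge> spectral_norm Q + 2 * \<omega> + 2 * norm A + 4 + 4 * C_z"
    and "0 < C_DFinv" "C_DFinv \<ge> 1 / c_gap * max (1 / \<omega>) (C_z / c_gap)"
    and "0 < \<kappa>_DF" "\<kappa>_DF \<ge> C_DF * C_DFinv"
    and "0 < C_\<delta>F" "C_\<delta>F \<ge> C_DF"
    and "0 < C_\<delta>DF" "C_\<delta>DF \<ge> 2"
    and "0 < C_\<delta>\<Delta>z" "C_\<delta>\<Delta>z \<ge> 2 * \<kappa>_DF"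
    and "0 < C_\<nu>"
        "C_\<nu> \<ge> max (2 * C_\<delta>\<Delta>z * (C_\<delta>F * C_DFinv + 2 / \<omega> * C_\<delta>DF * C_z)) (1 + C_DFinv * C_\<delta>F)"
    and "0 < \<nu>\<^sub>2" "\<nu>\<^sub>2 \<le> 0.1" "\<nu>\<^sub>2 \<le> c_gap / C_\<nu>" "\<nu>\<^sub>2 \<le> \<omega> / (2 * C_\<delta>DF * \<kappa>_DF)"
        "\<nu>\<^sub>2 \<le> \<theta> * \<sigma> * \<tau>\<^sub>E / (2 * C_\<nu> * C_\<delta>F)"
    and "0 < \<nu>\<^sub>1" "\<nu>\<^sub>1 \<le> \<nu>\<^sub>2 / C_\<nu>"
    and "0 < \<nu>\<^sub>0" "\<nu>\<^sub>0 \<le> \<nu>\<^sub>1 / C_\<nu>" "\<nu>\<^sub>0 \<le> tol / (2 * max (spectral_norm A) C_q)"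
    and "0 < const"
  shows "\<exists>\<epsilon>\<^sub>0>0. \<forall>\<epsilon>_mach. 0 < \<epsilon>_mach \<and> \<epsilon>_mach \<le> \<epsilon>\<^sub>0 \<longrightarrow>
    (\<forall>\<tau> z. \<tau> \<in> {\<sigma> * \<tau>\<^sub>E..\<sigma> * \<tau>\<^sub>A} \<and> z \<in> enlarge (nbhd Q c A b \<omega> \<theta> \<tau>) \<nu>\<^sub>1 \<longrightarrow>
      invertible (DF Q A \<omega> z) \<and>
      (\<forall>z'. computed_step (DF Q A \<omega> z) z (F Q c A b \<omega> \<tau> z) (const * C_z * \<kappa>_DF * \<epsilon>_mach) z'
        \<longrightarrow> z' \<in> enlarge (nbhd Q c A b \<omega> (0.5 * \<theta>) \<tau>) \<nu>\<^sub>2))"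
proof (intro exI conjI allI impI)
  define bound where "bound = const * C_z * \<kappa>_DF"
  have bound: "0 < bound" using assms by (simp add: bound_def)
  then show "0 < \<nu>\<^sub>2 / (2 * (const * C_z * \<kappa>_DF))"
    using \<open>0 < \<nu>\<^sub>2\<close> by (simp add: bound_def)
  have psd: "\<And>v. 0 \<le> v \<bullet> (Q *v v)" using \<open>sym_psd Q\<close> by (simp add: sym_psd_def)
  have n1: "1 \<le> n" unfolding n_def using zero_less_card_finite[where 'a = 'n] by simp
  have "1 \<le> sqrt (n + C_lam\<^sup>2 + C_\<mu>\<^sup>2)" using n1 by (simp add: add_increasing2)
  then have Cz: "1 \<le> C_z" using \<open>C_z \<ge> sqrt (n + C_lam\<^sup>2 + C_\<mu>\<^sup>2) + 0.1\<close> by linarith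
  have C_DF: "4 * C_z \<le> C_DF" "1 \<le> C_DF"
    using \<open>C_DF \<ge> _\<close> spectral_norm_nonneg[of Q] norm_ge_zero[of A] \<open>0 < \<omega>\<close> Cz by linarith+
  have C_\<nu>1: "1 \<le> C_\<nu>"
    using \<open>C_\<nu> \<ge> max _ _\<close> mult_pos_pos[OF \<open>0 < C_DFinv\<close> \<open>0 < C_\<delta>F\<close>] by simp
  have "\<nu>\<^sub>2 / C_\<nu> \<le> \<nu>\<^sub>2" "c_gap / C_\<nu> \<le> c_gap"
    using C_\<nu>1 \<open>0 < \<nu>\<^sub>2\<close> \<open>0 < c_gap\<close> by (simp_all add: divide_le_eq)
  then have \<nu>1: "\<nu>\<^sub>1 \<le> c_gap" "\<nu>\<^sub>1 \<le> 0.1"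
    using \<open>\<nu>\<^sub>1 \<le> \<nu>\<^sub>2 / C_\<nu>\<close> \<open>\<nu>\<^sub>2 \<le> c_gap / C_\<nu>\<close> \<open>\<nu>\<^sub>2 \<le> 0.1\<close> by linarith+
  fix \<epsilon>_mach \<tau> :: real and z :: "('n, 'm) iterate"
  assume \<epsilon>: "0 < \<epsilon>_mach \<and> \<epsilon>_mach \<le> \<nu>\<^sub>2 / (2 * (const * C_z * \<kappa>_DF))"
    and "\<tau> \<in> {\<sigma> * \<tau>\<^sub>E..\<sigma> * \<tau>\<^sub>A} \<and> z \<in> enlarge (nbhd Q c A b \<omega> \<theta> \<tau>) \<nu>\<^sub>1"
  then obtain z0 where \<tau>: "\<sigma> * \<tau>\<^sub>E \<le> \<tau>" "\<tau> \<le> \<sigma> * \<tau>\<^sub>A"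
    and z0: "z0 \<in> nbhd Q c A b \<omega> \<theta> \<tau>" and near: "norm (z - z0) \<le> \<nu>\<^sub>1"
    by (auto simp: enlarge_def)
  have \<tau>pos: "0 < \<tau>" using mult_pos_pos[OF \<open>0 < \<sigma>\<close> \<open>0 < \<tau>\<^sub>E\<close>] \<tau> by linarith
  have \<tau>_le: "\<tau> \<le> \<tau>\<^sub>A" using \<tau> \<open>\<sigma> < 1\<close> \<open>0 < \<tau>\<^sub>A\<close> by (smt (verit) mult_le_cancel_right1)
  \<comment> \<open>Stated for all radius factors up to \<open>\<theta>\<close> so that it covers both \<open>z0\<close> and the exact
    Newton point, which lies in the smaller neighbourhood.\<close>
  have in_ball: "norm z' + 0.1 \<le> C_z" if "z' \<in> nbhd Q c A b \<omega> t \<tau>" "t \<le> \<theta>" for t z'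
  proof -
    have "z' \<in> nbhd Q c A b \<omega> \<theta> \<tau>"
      using subsetD[OF nbhd_mono[OF that(2)] that(1)] \<tau>pos by simp
    then have "norm z' \<le> sqrt (n + C_lam\<^sup>2 + C_\<mu>\<^sup>2)"
      using \<open>0 < \<theta>\<close> unfolding n_def
      by (rule nbhd_norm_le[OF _ \<open>0 < \<omega>\<close> less_imp_le \<tau>pos \<tau>_le
            \<open>C_lam \<ge> _\<close>[unfolded n_def] \<open>C_\<Delta>\<mu> \<ge> _\<close>[unfolded n_def] \<open>C_\<mu> \<ge> _\<close>[unfolded n_def]])
    then show ?thesis using \<open>C_z \<ge> sqrt (n + C_lam\<^sup>2 + C_\<mu>\<^sup>2) + 0.1\<close> by linarith
  qed
  have z0_le: "norm z0 + 0.1 \<le> C_z" using in_ball[OF z0] \<open>0 < \<theta>\<close> by simp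
  have "2 * (1 + C_z) * c_gap \<le> 2 * (1 + C_z) * ((1 - \<theta>) / (1 + C_z) * (\<sigma> * \<tau>\<^sub>E / 2))"
    using \<open>c_gap \<le> _\<close> Cz by (intro mult_left_mono) auto
  also have "\<dots> = (1 - \<theta>) * (\<sigma> * \<tau>\<^sub>E)" using Cz by (simp add: field_simps)
  also have "\<dots> \<le> (1 - \<theta>) * \<tau>" using \<tau> \<open>\<theta> \<le> 0.3\<close> by (intro mult_left_mono) auto
  finally have gap: "2 * (1 + C_z) * c_gap \<le> (1 - \<theta>) * \<tau>" .
  define K where "K = 1 / c_gap * max (1 / \<omega>) (C_z / c_gap)"
  have K_le: "K \<le> C_DFinv" using \<open>C_DFinv \<ge> _\<close> unfolding K_def .
  have bounded_below: "norm d \<le> C_DFinv * norm (DF Q A \<omega> y *v d)" if "norm (y - z0) \<le> \<nu>\<^sub>1" for y d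
  proof -
    have "norm d \<le> K * norm (DF Q A \<omega> y *v d)" unfolding K_def
      by (rule DF_inverse_bound_near_nbhd[OF z0 _ that])
        (use z0_le \<nu>1 psd \<open>0 < \<omega>\<close> \<open>0 < c_gap\<close> Cz gap in auto)
    then show ?thesis using mult_right_mono[OF K_le] norm_ge_zero order_trans by blast
  qed
  have inv: "invertible (DF Q A \<omega> z)" "invertible (DF Q A \<omega> z0)"
    using near \<open>0 < \<nu>\<^sub>1\<close> by (intro invertible_if_bounded_below[OF bounded_below]; simp)+
  show "invertible (DF Q A \<omega> z)" by (rule inv)
  have "c_gap \<le> 1 / 2"
    by (rule DF_inverse_bound_near_nbhd(2)[OF z0 _ near])
      (use z0_le \<nu>1 psd \<open>0 < \<omega>\<close> \<open>0 < c_gap\<close> Cz gap in auto)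
  then have "1 \<le> C_z / c_gap" "1 \<le> 1 / c_gap" using Cz \<open>0 < c_gap\<close> by simp_all
  then have "1 * 1 \<le> K" unfolding K_def by (intro mult_mono) (use \<open>0 < c_gap\<close> in \<open>simp_all add: le_max_iff_disj\<close>)
  then have Cinv: "1 \<le> C_DFinv" using K_le by simp
  \<comment> \<open>The constant \<open>C_\<nu>\<close> is at least twice the factor \<open>8 * C_z * C_DFinv\<close> that is needed below;
    the slack leaves room for rounding.\<close>
  have C_\<nu>: "16 * C_z * C_DFinv \<le> C_\<nu>"
  proof -
    have "16 * C_z * C_DFinv \<le> 4 * (C_DF * C_DFinv)" using C_DF Cinv by simp
    also have "\<dots> \<le> 2 * C_\<delta>\<Delta>z" using \<open>\<kappa>_DF \<ge> C_DF * C_DFinv\<close> \<open>C_\<delta>\<Delta>z \<ge> 2 * \<kappa>_DF\<close> by simp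
    also have "\<dots> \<le> 2 * C_\<delta>\<Delta>z * (C_\<delta>F * C_DFinv + 2 / \<omega> * C_\<delta>DF * C_z)"
    proof -
      have "1 \<le> C_\<delta>F * C_DFinv" using mult_mono[of 1 C_\<delta>F 1 C_DFinv] \<open>C_\<delta>F \<ge> C_DF\<close> C_DF Cinv by simp
      moreover have "0 \<le> 2 / \<omega> * C_\<delta>DF * C_z" using assms by simp
      ultimately show ?thesis using \<open>0 < C_\<delta>\<Delta>z\<close> by simp
    qed
    finally show ?thesis using \<open>C_\<nu> \<ge> max _ _\<close> unfolding max.bounded_iff by linarith
  qed
  fix z'
  assume "computed_step (DF Q A \<omega> z) z (F Q c A b \<omega> \<tau> z) (const * C_z * \<kappa>_DF * \<epsilon>_mach) z'"
  then obtain e where e: "norm e \<le> bound * \<epsilon>_mach" and z': "z' = z - matrix_inv (DF Q A \<omega> z) *v F Q c A b \<omega> \<tau> z + e"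
    unfolding computed_step_def bound_def by blast
  define d where "d = - (matrix_inv (DF Q A \<omega> z) *v F Q c A b \<omega> \<tau> z)"
  define d0 where "d0 = - (matrix_inv (DF Q A \<omega> z0) *v F Q c A b \<omega> \<tau> z0)"
  have d: "DF Q A \<omega> z *v d = - F Q c A b \<omega> \<tau> z" and d0: "DF Q A \<omega> z0 *v d0 = - F Q c A b \<omega> \<tau> z0"
    unfolding d_def d0_def using inv by (simp_all only: matrix_inv_solves)
  have z1: "z0 + d0 \<in> nbhd Q c A b \<omega> (0.5 * \<theta>) \<tau>"
    using newton_step_mem_nbhd[OF z0 d0 psd] \<open>0 < \<omega>\<close> \<open>0 < \<theta>\<close> \<open>\<theta> \<le> 0.3\<close> \<tau>pos by simp
  have z1_le: "norm (z0 + d0) + 0.1 \<le> C_z" using in_ball[OF z1] \<open>0 < \<theta>\<close> by simp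
  have "norm d0 \<le> 2 * C_z" using norm_triangle_ineq4[of "z0 + d0" z0] z1_le z0_le by simp
  moreover have "norm (z0 + d0 - z) \<le> 2 * C_z"
    using norm_triangle_ineq4[of "z0 + d0" z] norm_triangle_sub[of z z0] near \<nu>1 z1_le z0_le by simp
  moreover have "norm (z0 + d0 - z - d0) \<le> \<nu>\<^sub>1" using near by (simp add: norm_minus_commute)
  ultimately have "2 * (norm (z0 + d0 - z) + norm d0) * norm (z0 + d0 - z - d0) \<le> 2 * (4 * C_z) * \<nu>\<^sub>1"
    using Cz by (intro mult_mono) auto
  then have "norm (newton_remainder (z0 + d0 - z) - newton_remainder d0) \<le> 8 * C_z * \<nu>\<^sub>1"
    using newton_remainder_diff_le[of "z0 + d0 - z" d0] by simp
  then have "norm (z + d - (z0 + d0)) \<le> C_DFinv * (8 * C_z * \<nu>\<^sub>1)"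
    using bounded_below[OF near, of "z + d - (z0 + d0)"] newton_step_perturbation[OF d0 d] Cinv
    by (smt (verit) mult_left_mono)
  also have "\<dots> \<le> C_\<nu> * \<nu>\<^sub>1 / 2"
    using mult_right_mono[OF C_\<nu>, of \<nu>\<^sub>1] \<open>0 < \<nu>\<^sub>1\<close> by (simp add: ac_simps)
  also have "\<dots> \<le> \<nu>\<^sub>2 / 2"
    using \<open>\<nu>\<^sub>1 \<le> \<nu>\<^sub>2 / C_\<nu>\<close> C_\<nu>1 by (simp add: le_divide_eq mult.commute)
  finally have exact: "norm (z + d - (z0 + d0)) \<le> \<nu>\<^sub>2 / 2" .
  have "\<epsilon>_mach \<le> \<nu>\<^sub>2 / (2 * bound)" using \<epsilon> by (simp only: bound_def)
  then have "bound * \<epsilon>_mach \<le> \<nu>\<^sub>2 / 2" using bound by (simp add: le_divide_eq ac_simps)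
  then have "norm (z' - (z0 + d0)) \<le> \<nu>\<^sub>2"
    using norm_triangle_ineq[of "z + d - (z0 + d0)" e] exact e unfolding z' d_def by (simp add: algebra_simps)
  then show "z' \<in> enlarge (nbhd Q c A b \<omega> (0.5 * \<theta>) \<tau>) \<nu>\<^sub>2"
    using z1 by (auto simp: enlarge_def)
qed

end
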